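(* Let $C_n^{(3)}(t)=a(2n+2,2,t)$ for $n\ge 0$, where the polynomials $a(n,j,t)$ are as defined in the context. Then for all integers $n\ge 0$ $$\det\bigl(C_{i+j}^{(3)}(t)\bigr)_{i,j=0}^{n-1}=t^{\binom n2}\sum_{k=0}^{\lfloor n/2\rfloor}(-1)^k\binom{n-k}{k}t^{-k}.$$
   Context: The polynomials $a(n,j,t)$ in the indeterminate $t$ ($n\ge 0$, $j\in\mathbb Z$) are defined by $a(0,j,t)=1$ if $j=0$ and $0$ otherwise, $a(n,j,t)=0$ for $j<0$, and, for $n\ge 1$ and $k\ge 0$, $$a(n,2k,t)=a(n-1,2k-1,t)+a(n-1,2k+1,t),$$ $$a(n,2k+1,t)=a(n-1,2k,t)+t\,a(n-1,2k+2,t).$$ The first terms of $C_n^{(3)}(t)$ are $1,\ 2+t,\ 3+5t+t^2,\ 4+14t+9t^2+t^3,\dots$. The identity is understood in Laurent polynomials in $t$ (the right-hand side is in fact a polynomial). The determinant of the empty ($0\times 0$) matrix is $1$. *)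

theory Defs
  imports
    "HOL-Computational_Algebra.Polynomial"
    "HOL-Library.Poly_Mapping"
    "Jordan_Normal_Form.Determinant"
begin

text \<open>
  The polynomials \<open>a(n, j, t)\<close>, as elements of \<open>\<int>[t]\<close>, with \<open>t\<close> represented by \<open>[:0, 1:]\<close>.
  The recurrence for index \<open>2k\<close> and the one for index \<open>2k+1\<close> are both written in terms of the
  index \<open>j\<close> itself; \<open>apoly_even\<close> and \<open>apoly_odd\<close> below restate them in terms of \<open>k\<close>.
\<close>

fun apoly :: "nat \<Rightarrow> int \<Rightarrow> int poly" where
  "apoly 0 j = (if j = 0 then 1 else 0)"
| "apoly (Suc n) j =
     (if j < 0 then 0
      else if even j then apoly n (j - 1) + apoly n (j + 1)
      else apoly n (j - 1) + [:0, 1:] * apoly n (j + 1))"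

lemma apoly_neg: "j < 0 \<Longrightarrow> apoly n j = 0"
  by (cases n) auto

lemma apoly_even:
  assumes "n \<ge> 1" and "k \<ge> 0"
  shows "apoly n (2 * k) = apoly (n - 1) (2 * k - 1) + apoly (n - 1) (2 * k + 1)"
  using assms by (cases n) auto

lemma apoly_odd:
  assumes "n \<ge> 1" and "k \<ge> 0"
  shows "apoly n (2 * k + 1) = apoly (n - 1) (2 * k) + [:0, 1:] * apoly (n - 1) (2 * k + 2)"
  using assms by (cases n) (auto simp: add.commute)

definition C3 :: "nat \<Rightarrow> int poly" where
  "C3 n = apoly (2 * n + 2) 2"

lemma C3_first_terms:
  "C3 0 = 1" "C3 1 = [:2, 1:]" "C3 2 = [:3, 5, 1:]" "C3 3 = [:4, 14, 9, 1:]"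
  by (simp_all add: C3_def eval_nat_numeral one_pCons)

text \<open>
  The Laurent polynomials \<open>\<int>[t, t\<^sup>-\<^sup>1]\<close> are the finitely supported functions from exponents to
  coefficients, with the convolution product of \<^theory>\<open>HOL-Library.Poly_Mapping\<close>.
\<close>

type_synonym laurent_poly = "int \<Rightarrow>\<^sub>0 int"

definition tpow :: "int \<Rightarrow> laurent_poly" where
  "tpow m = Poly_Mapping.single m 1"

lemma tpow_0: "tpow 0 = 1"
  by (simp add: tpow_def)

lemma tpow_add: "tpow (l + m) = tpow l * tpow m"
  by (simp add: tpow_def Poly_Mapping.mult_single)

text \<open>The inclusion of \<open>\<int>[t]\<close> into \<open>\<int>[t, t\<^sup>-\<^sup>1]\<close>.\<close>

definition laurent_of_poly :: "int poly \<Rightarrow> laurent_poly" where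
  "laurent_of_poly p = (\<Sum>i\<le>degree p. Poly_Mapping.single (int i) (coeff p i))"

lemma lookup_laurent_of_poly:
  "Poly_Mapping.lookup (laurent_of_poly p) m = (if m < 0 then 0 else coeff p (nat m))"
proof -
  have "Poly_Mapping.lookup (laurent_of_poly p) m =
          (\<Sum>i\<le>degree p. if int i = m then coeff p i else 0)"
    by (simp add: laurent_of_poly_def Poly_Mapping.lookup_sum Poly_Mapping.lookup_single when_def)
  also have "\<dots> = (if m < 0 then 0 else coeff p (nat m))"
  proof (cases "m < 0")
    case True
    then show ?thesis by (auto intro!: sum.neutral)
  next
    case False
    then have "int i = m \<longleftrightarrow> i = nat m" for i by auto
    then show ?thesis using False by (simp add: coeff_eq_0)
  qed
  finally show ?thesis .
qed

end

theory Submission imports Defs begin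

text \<open>
  On odd indices, two steps of the recurrence for \<open>a\<close> form a tridiagonal Toeplitz transfer operator
  \<open>Q\<close>, with \<open>1 + t\<close> on the diagonal and \<open>1\<close>, \<open>t\<close> next to it. With \<open>D = diag(1, t, t\<^sup>2, \<dots>)\<close>, the
  operator \<open>Q D\<close> is symmetric and \<open>t C\<^sub>n\<close> is the top left entry of \<open>Q\<^sup>n (Q - 1)\<close>. Hence the Hankel
  matrix factors as \<open>A N A\<^sup>T\<close>, where \<open>A\<close> is lower unitriangular with rows \<open>e\<^sub>0 Q\<^sup>i\<close>, and
  \<open>N = (Q - 1) D / t\<close> is tridiagonal with entries \<open>t\<^sup>k\<close> at \<open>(k, k)\<close>, \<open>(k, k + 1)\<close>, \<open>(k + 1, k)\<close>.
  The three-term recurrence for \<open>det N\<close> is that of the right-hand side.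
\<close>

section \<open>Determinants of tridiagonal matrices\<close>

definition tridiag :: "(nat \<Rightarrow> 'a::comm_ring_1) \<Rightarrow> (nat \<Rightarrow> 'a) \<Rightarrow> (nat \<Rightarrow> 'a) \<Rightarrow> nat \<Rightarrow> 'a mat" where
  "tridiag a b c n = mat n n (\<lambda>(i, j).
     if i = j then a i else if j = Suc i then b i else if i = Suc j then c j else 0)"

lemma tridiag_carrier [simp]: "tridiag a b c n \<in> carrier_mat n n"
  by (simp add: tridiag_def)

lemma det_tridiag_0: "det (tridiag a b c 0) = 1"
  by (simp add: det_dim_zero)

lemma det_tridiag_1: "det (tridiag a b c (Suc 0)) = a 0"
  by (subst det_single) (auto simp: tridiag_def)

text \<open>Expand along the last row. In the minor left by the entry \<open>c n\<close>, the last
  column has the single nonzero entry \<open>b n\<close>, so a second expansion leads back to a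
  matrix of the same family.\<close>

lemma det_tridiag_Suc_Suc:
  "det (tridiag a b c (Suc (Suc n))) =
     a (Suc n) * det (tridiag a b c (Suc n)) - b n * c n * det (tridiag a b c n)"
proof -
  let ?A = "tridiag a b c (Suc (Suc n))"
  let ?M = "mat_delete ?A (Suc n) n"
  have M: "?M \<in> carrier_mat (Suc n) (Suc n)"
    by (rule carrier_matI) (simp_all add: mat_delete_def tridiag_def)
  have del1: "mat_delete ?A (Suc n) (Suc n) = tridiag a b c (Suc n)"
    by (rule eq_matI) (auto simp: tridiag_def mat_delete_def)
  have del2: "mat_delete ?M n n = tridiag a b c n"
    by (rule eq_matI) (auto simp: tridiag_def mat_delete_def)
  have entM: "?M $$ (i, n) = (if i = n then b n else 0)" if "i < Suc n" for i
    using that by (auto simp: tridiag_def mat_delete_def)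
  have "det ?M = (\<Sum>i<Suc n. ?M $$ (i, n) * cofactor ?M i n)"
    by (rule laplace_expansion_column[OF M]) simp
  also have "\<dots> = (\<Sum>i<Suc n. if i = n then b n * cofactor ?M n n else 0)"
    by (rule sum.cong) (auto simp: entM)
  also have "\<dots> = b n * det (tridiag a b c n)"
    by (simp add: cofactor_def del2 flip: mult_2)
  finally have detM: "det ?M = b n * det (tridiag a b c n)" .
  have entA: "?A $$ (Suc n, j) = (if j = Suc n then a (Suc n) else if j = n then c n else 0)"
    if "j < Suc (Suc n)" for j
    using that by (auto simp: tridiag_def)
  have "det ?A = (\<Sum>j<Suc (Suc n). ?A $$ (Suc n, j) * cofactor ?A (Suc n) j)"
    by (rule laplace_expansion_row[OF tridiag_carrier]) simp
  also have "\<dots> = (\<Sum>j<n. ?A $$ (Suc n, j) * cofactor ?A (Suc n) j)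
      + c n * cofactor ?A (Suc n) n + a (Suc n) * cofactor ?A (Suc n) (Suc n)"
    by (simp add: entA)
  also have "(\<Sum>j<n. ?A $$ (Suc n, j) * cofactor ?A (Suc n) j) = 0"
    by (rule sum.neutral) (auto simp: entA)
  also have "cofactor ?A (Suc n) n = - (b n * det (tridiag a b c n))"
    by (simp add: cofactor_def detM flip: mult_2)
  also have "cofactor ?A (Suc n) (Suc n) = det (tridiag a b c (Suc n))"
    by (simp add: cofactor_def del1 flip: mult_2)
  finally show ?thesis
    by (simp add: algebra_simps)
qed

section \<open>The transfer matrix on odd indices\<close>

abbreviation T :: "int poly" where
  "T \<equiv> [:0, 1:]"

text \<open>Starting after one step makes the row \<open>i = 0\<close> the unit vector at
  \<open>k = 0\<close>; each increase of \<open>i\<close> is then two steps of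
  \<open>apoly\<close>.\<close>

definition odd_apoly :: "nat \<Rightarrow> nat \<Rightarrow> int poly" where
  "odd_apoly i k = apoly (2 * i + 1) (2 * int k + 1)"

lemma odd_apoly_0: "odd_apoly 0 k = (if k = 0 then 1 else 0)"
  by (simp add: odd_apoly_def)

lemma odd_apoly_Suc_0:
  "odd_apoly (Suc i) 0 = (1 + T) * odd_apoly i 0 + T * odd_apoly i 1"
  by (simp add: odd_apoly_def apoly_neg algebra_simps)

lemma odd_apoly_Suc_Suc:
  "odd_apoly (Suc i) (Suc k) =
     odd_apoly i k + (1 + T) * odd_apoly i (Suc k) + T * odd_apoly i (Suc (Suc k))"
  by (simp add: odd_apoly_def algebra_simps)

lemma odd_apoly_above: "k > i \<Longrightarrow> odd_apoly i k = 0"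
proof (induction i arbitrary: k)
  case 0
  then show ?case by (simp add: odd_apoly_0)
next
  case (Suc i)
  then show ?case by (cases k) (auto simp: odd_apoly_Suc_Suc)
qed

lemma odd_apoly_diag: "odd_apoly i i = 1"
  by (induction i) (auto simp: odd_apoly_0 odd_apoly_Suc_Suc odd_apoly_above)

lemma C3_odd_apoly: "C3 i = odd_apoly i 0 + odd_apoly i 1"
  by (simp add: C3_def odd_apoly_def)

section \<open>Factorization of the Hankel matrix\<close>

definition gram :: "nat \<Rightarrow> int poly mat" where
  "gram = tridiag (\<lambda>k. T ^ k) (\<lambda>k. T ^ k) (\<lambda>k. T ^ k)"

text \<open>The product of row \<open>i\<close> of \<open>odd_apoly\<close> with column
  \<open>l\<close> of the infinite matrix behind \<open>gram\<close>. Being free of the size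
  \<open>n\<close>, it obeys a recurrence in \<open>i\<close> without truncation terms.\<close>

definition odd_gram :: "nat \<Rightarrow> nat \<Rightarrow> int poly" where
  "odd_gram i l = T ^ l * (odd_apoly i l + odd_apoly i (Suc l)) +
     (case l of 0 \<Rightarrow> 0 | Suc m \<Rightarrow> T ^ m * odd_apoly i m)"

text \<open>The transfer matrix of \<^const>\<open>odd_apoly\<close> is self-adjoint for the form \<^const>\<open>gram\<close>.\<close>

lemma odd_gram_Suc:
  "odd_gram (Suc i) l = odd_gram i (Suc l) + (1 + T) * odd_gram i l +
     (case l of 0 \<Rightarrow> 0 | Suc m \<Rightarrow> T * odd_gram i m)"
proof (cases l)
  case 0
  then show ?thesis
    by (simp add: odd_gram_def odd_apoly_Suc_0 odd_apoly_Suc_Suc algebra_simps)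
next
  case (Suc m)
  then show ?thesis
    by (cases m)
       (simp_all add: odd_gram_def odd_apoly_Suc_0 odd_apoly_Suc_Suc algebra_simps)
qed

text \<open>Induction on \<open>j\<close> moves one transfer step at a time from the right factor to
  the left one, by self-adjointness; \<open>i\<close> therefore has to be arbitrary. For
  \<open>j = 0\<close> only the term \<open>l = 0\<close> survives.\<close>

lemma sum_odd_gram: "j < K \<Longrightarrow> (\<Sum>l<K. odd_gram i l * odd_apoly j l) = C3 (i + j)"
proof (induction j arbitrary: i K)
  case 0
  then obtain K' where "K = Suc K'" by (cases K) auto
  show ?case
    unfolding \<open>K = Suc K'\<close> sum.lessThan_Suc_shift
    by (simp add: odd_apoly_0 odd_gram_def C3_odd_apoly)
next
  case (Suc j)
  then obtain K' where K: "K = Suc K'" and jK': "j < K'" by (cases K) auto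
  let ?w = "odd_gram i" and ?a = "odd_apoly j"
  \<comment> \<open>These zeros allow the sums over \<open>K\<close> and \<open>K'\<close> to be
    exchanged, so cutting off the matrices causes no boundary terms.\<close>
  have top: "?a K' = 0" "?a (Suc K') = 0"
    using jK' by (simp_all add: odd_apoly_above)
  have "(\<Sum>l<K. ?w l * odd_apoly (Suc j) l) =
      (\<Sum>l<K'. ?w (Suc l) * ?a l) + (1 + T) * (\<Sum>l<K. ?w l * ?a l) + T * (\<Sum>l<K. ?w l * ?a (Suc l))"
    unfolding K sum.lessThan_Suc_shift
    by (simp add: odd_apoly_Suc_0 odd_apoly_Suc_Suc distrib_left distrib_right sum.distrib
        sum_distrib_left mult.left_commute mult.assoc del: mult_pCons_left mult_pCons_right)
  also have "(\<Sum>l<K'. ?w (Suc l) * ?a l) = (\<Sum>l<K. ?w (Suc l) * ?a l)"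
    by (simp add: K top)
  also have "T * (\<Sum>l<K. ?w l * ?a (Suc l)) =
      (\<Sum>l<K. (case l of 0 \<Rightarrow> 0 | Suc m \<Rightarrow> T * ?w m) * ?a l)"
  proof -
    have "T * (\<Sum>l<K. ?w l * ?a (Suc l)) = T * (\<Sum>l<K'. ?w l * ?a (Suc l))"
      by (simp add: K top)
    also have "\<dots> = (\<Sum>l<K. (case l of 0 \<Rightarrow> 0 | Suc m \<Rightarrow> T * ?w m) * ?a l)"
      unfolding K sum.lessThan_Suc_shift
      by (simp add: sum_distrib_left mult.assoc del: mult_pCons_left mult_pCons_right)
    finally show ?thesis .
  qed
  finally have "(\<Sum>l<K. ?w l * odd_apoly (Suc j) l) = (\<Sum>l<K. odd_gram (Suc i) l * ?a l)"
    by (simp add: odd_gram_Suc distrib_right sum.distrib sum_distrib_left mult.assoc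
        del: mult_pCons_left mult_pCons_right)
  also have "\<dots> = C3 (i + Suc j)"
    using Suc.IH[of K "Suc i"] Suc.prems by simp
  finally show ?case .
qed

lemma sum_odd_apoly_gram:
  assumes "i < n" "l < n"
  shows "(\<Sum>k<n. odd_apoly i k * gram n $$ (k, l)) = odd_gram i l"
proof -
  have "(\<Sum>k<n. odd_apoly i k * gram n $$ (k, l)) =
      (\<Sum>k<n. (if k = l then T ^ l * odd_apoly i l else 0)
        + (if k = Suc l then T ^ l * odd_apoly i (Suc l) else 0)
        + (if Suc k = l then T ^ k * odd_apoly i k else 0))"
    using assms by (intro sum.cong) (auto simp: gram_def tridiag_def)
  also have "\<dots> = T ^ l * odd_apoly i l + T ^ l * odd_apoly i (Suc l)
      + (\<Sum>k<n. if Suc k = l then T ^ k * odd_apoly i k else 0)"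
    \<comment> \<open>For \<open>Suc l = n\<close> the neighbour below the diagonal falls outside
      the matrix, but then \<open>odd_apoly i (Suc l)\<close> vanishes because
      \<open>i < n\<close>.\<close>
    using assms odd_apoly_above[of i "Suc l"]
    by (cases "Suc l < n") (simp_all add: sum.distrib)
  also have "(\<Sum>k<n. if Suc k = l then T ^ k * odd_apoly i k else 0) =
      (case l of 0 \<Rightarrow> 0 | Suc m \<Rightarrow> T ^ m * odd_apoly i m)"
    using assms by (cases l) simp_all
  finally show ?thesis
    by (simp add: odd_gram_def distrib_left)
qed

lemma det_C3: "det (mat n n (\<lambda>(i, j). C3 (i + j))) = det (gram n)"
proof -
  define A where "A = mat n n (\<lambda>(i, k). odd_apoly i k)"
  have A [simp]: "A \<in> carrier_mat n n" by (simp add: A_def)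
  have G [simp]: "gram n \<in> carrier_mat n n" by (simp add: gram_def)
  have AG: "A * gram n = mat n n (\<lambda>(i, l). odd_gram i l)"
    using carrier_matD[OF G]
    by (intro eq_matI)
       (auto simp: A_def scalar_prod_def atLeast0LessThan simp flip: sum_odd_apoly_gram)
  have "mat n n (\<lambda>(i, j). C3 (i + j)) = A * gram n * transpose_mat A"
    unfolding AG by (intro eq_matI) (auto simp: A_def scalar_prod_def atLeast0LessThan sum_odd_gram)
  moreover have "det A = 1"
    by (subst det_lower_triangular[of n])
       (auto simp: A_def odd_apoly_above odd_apoly_diag prod_list_diag_prod)
  ultimately show ?thesis
    by (simp add: det_mult[of _ n] det_transpose[of A n] mult_carrier_mat[of _ n n])
qed

section \<open>Passage to Laurent polynomials\<close>

lemma laurent_of_poly_diff: "laurent_of_poly (p - q) = laurent_of_poly p - laurent_of_poly q"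
  by (rule poly_mapping_eqI) (simp add: lookup_laurent_of_poly lookup_minus)

lemma laurent_of_poly_1: "laurent_of_poly 1 = 1"
  by (simp add: laurent_of_poly_def)

lemma laurent_of_poly_T_mult: "laurent_of_poly (T * p) = tpow 1 * laurent_of_poly p"
proof (cases "p = 0")
  case True
  then show ?thesis by (simp add: laurent_of_poly_def)
next
  \<comment> \<open>Only for nonzero \<open>p\<close> does multiplication by \<open>T\<close> raise
    the degree, and with it the range of the sum, by one.\<close>
  case False
  then show ?thesis
    by (simp add: laurent_of_poly_def tpow_def sum.atMost_Suc_shift sum_distrib_left mult_single
        del: sum.atMost_Suc)
qed

lemma laurent_of_poly_T_power_mult: "laurent_of_poly (T ^ m * p) = tpow (int m) * laurent_of_poly p"
proof (induction m)
  case 0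
  then show ?case by (simp add: tpow_0)
next
  case (Suc m)
  have "laurent_of_poly (T ^ Suc m * p) = tpow 1 * laurent_of_poly (T ^ m * p)"
    using laurent_of_poly_T_mult[of "T ^ m * p"] by (simp only: power_Suc mult.assoc)
  also have "\<dots> = tpow (int (Suc m)) * laurent_of_poly p"
    by (simp only: Suc.IH of_nat_Suc tpow_add mult.assoc)
  finally show ?case .
qed

section \<open>Fibonacci polynomials and evaluation of the determinant\<close>

text \<open>At \<open>x = 1\<close> these are the Fibonacci numbers. The terms with
  \<open>2 * k > n\<close> vanish; summing up to \<open>n\<close> avoids parity cases when the index
  is shifted.\<close>

definition fib_poly :: "'a::comm_ring_1 \<Rightarrow> nat \<Rightarrow> 'a" where
  "fib_poly x n = (\<Sum>k\<le>n. of_nat ((n - k) choose k) * x ^ k)"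

text \<open>Pascal's rule splits the coefficient of \<open>x ^ Suc k\<close>.\<close>

lemma fib_poly_Suc_Suc: "fib_poly x (Suc (Suc n)) = fib_poly x (Suc n) + x * fib_poly x n"
proof -
  have "fib_poly x (Suc (Suc n)) = 1 + (\<Sum>k\<le>n. of_nat ((Suc n - k) choose Suc k) * x ^ Suc k)"
    unfolding fib_poly_def sum.atMost_Suc_shift[of _ "Suc n"] by simp
  also have "\<dots> = 1 + (\<Sum>k\<le>n. of_nat ((n - k) choose Suc k) * x ^ Suc k
      + of_nat ((n - k) choose k) * x ^ Suc k)"
    by (intro arg_cong2[where f = "(+)"] sum.cong) (auto simp: Suc_diff_le algebra_simps)
  also have "\<dots> = fib_poly x (Suc n) + x * fib_poly x n"
    unfolding fib_poly_def sum.atMost_Suc_shift[of _ n]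
    by (simp add: sum.distrib sum_distrib_left mult.left_commute)
  finally show ?thesis .
qed

lemma fib_poly_eq: "fib_poly x n = (\<Sum>k=0..n div 2. of_nat ((n - k) choose k) * x ^ k)"
  unfolding fib_poly_def by (intro sum.mono_neutral_right) (auto simp: binomial_eq_0)

text \<open>Both sides satisfy the same three-term recurrence, with \<open>x = -1/t\<close> on the
  right.\<close>

lemma laurent_of_poly_det_gram:
  "laurent_of_poly (det (gram n)) = tpow (int (n choose 2)) * fib_poly (- tpow (- 1)) n"
proof (induction n rule: induct_nat_012)
  case 0
  then show ?case by (simp add: gram_def det_tridiag_0 laurent_of_poly_1 fib_poly_def tpow_0 binomial_eq_0)
next
  case 1
  then show ?case by (simp add: gram_def det_tridiag_1 laurent_of_poly_1 fib_poly_def tpow_0 binomial_eq_0)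
next
  case (ge2 n)
  have ch: "Suc (Suc n) choose 2 = Suc n + (Suc n choose 2)" "Suc n choose 2 = n + (n choose 2)"
    by (simp_all add: numeral_2_eq_2)
  have "laurent_of_poly (det (gram (Suc (Suc n)))) =
      tpow (int (Suc n)) * laurent_of_poly (det (gram (Suc n)))
      - tpow (int (n + n)) * laurent_of_poly (det (gram n))"
    unfolding gram_def det_tridiag_Suc_Suc
    by (simp only: laurent_of_poly_diff laurent_of_poly_T_power_mult flip: power_add)
  also have "tpow (int (Suc n)) * laurent_of_poly (det (gram (Suc n))) =
      tpow (int (Suc (Suc n) choose 2)) * fib_poly (- tpow (- 1)) (Suc n)"
    unfolding ge2 ch(1) by (simp add: tpow_add mult.assoc)
  \<comment> \<open>The exponent \<open>2 * n + (n choose 2)\<close> is one less than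
    \<open>Suc (Suc n) choose 2\<close>, which produces the factor
    \<open>tpow (- 1)\<close>.\<close>
  also have "tpow (int (n + n)) * laurent_of_poly (det (gram n)) =
      tpow (int (Suc (Suc n) choose 2)) * (tpow (- 1) * fib_poly (- tpow (- 1)) n)"
    unfolding ge2 ch mult.assoc[symmetric] tpow_add[symmetric] by simp
  finally show ?case
    by (simp add: fib_poly_Suc_Suc algebra_simps)
qed

lemma uminus_tpow_power: "(- tpow (- 1)) ^ k = (- 1) ^ k * tpow (- int k)"
proof (induction k)
  case (Suc k)
  have "tpow (- int (Suc k)) = tpow (- 1) * tpow (- int k)"
    by (simp flip: tpow_add)
  then show ?case by (simp add: Suc.IH algebra_simps)
qed (simp add: tpow_0)

theorem theorem5p2:
  fixes n :: nat
  shows "laurent_of_poly (det (mat n n (\<lambda>(i, j). C3 (i + j)))) =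
    tpow (int (n choose 2)) *
      (\<Sum>k=0..n div 2. (- 1) ^ k * of_nat ((n - k) choose k) * tpow (- int k))"
  by (simp add: det_C3 laurent_of_poly_det_gram fib_poly_eq uminus_tpow_power
      mult.assoc mult.left_commute)

end
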